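(* Let $S$ be a non-empty set, and let $\mathrm{Fun}_{00}(S)$ be the vector space of all real-valued functions on $S$ with finite support. For $s\in S$, define $j(s):\mathrm{Fun}_{00}(S)\to\mathbb{R}$ by setting $[j(s)](f):=f(s)$ for $f\in\mathrm{Fun}_{00}(S)$. Let $\mathcal{F}$ be the vector sublattice of $\mathrm{Fun}(\mathrm{Fun}_{00}(S))$ that is generated by $j(S)$, where $\mathrm{Fun}(\mathrm{Fun}_{00}(S))$ is the vector lattice of all real-valued functions on the set $\mathrm{Fun}_{00}(S)$. Then $(j,\mathcal{F})$ is a free vector lattice over the set $S$.
   Context: All vector spaces and vector lattices are over $\mathbb{R}$; vector lattices are not assumed to be Archimedean. For a non-empty set $X$, $\mathrm{Fun}(X)$ is the vector lattice of all functions $X\to\mathbb{R}$ with pointwise operations and ordering. The vector sublattice generated by a subset of a vector lattice is the smallest vector sublattice containing that subset. A free vector lattice over a set $S$ is a pair $(j,F)$, where $F$ is a vector lattice and $j:S\to F$ is a map, such that for every vector lattice $G$ and every map $\varphi:S\to G$ there exists a unique vector lattice homomorphism $\overline{\varphi}:F\to G$ with $\overline{\varphi}\circ j=\varphi$. *)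

theory Defs
  imports Complex_Main "HOL-Algebra.Module" "HOL-Algebra.Lattice"
begin

section \<open>Vector lattices\<close>

definition real_field :: "real ring" where
  "real_field = \<lparr>carrier = UNIV, mult = (*), one = 1, zero = 0, add = (+)\<rparr>"

text \<open>
  A real vector space is a module over the field of real numbers. As usual for modules in
  HOL-Algebra, the fields \<open>mult\<close> and \<open>one\<close> inherited from rings play no role.
\<close>

record 'v ordered_vs = "(real, 'v) module" +
  vle :: "'v \<Rightarrow> 'v \<Rightarrow> bool"

definition vorder :: "'v ordered_vs \<Rightarrow> 'v gorder" where
  "vorder V = \<lparr>carrier = carrier V, eq = (=), le = vle V\<rparr>"

locale vector_lattice = module real_field V + lattice "vorder V" for V :: "'v ordered_vs" +
  assumes vle_add: "\<lbrakk>x \<in> carrier V; y \<in> carrier V; z \<in> carrier V; vle V x y\<rbrakk>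
      \<Longrightarrow> vle V (x \<oplus>\<^bsub>V\<^esub> z) (y \<oplus>\<^bsub>V\<^esub> z)"
    and vle_smult: "\<lbrakk>x \<in> carrier V; y \<in> carrier V; 0 \<le> a; vle V x y\<rbrakk>
      \<Longrightarrow> vle V (a \<odot>\<^bsub>V\<^esub> x) (a \<odot>\<^bsub>V\<^esub> y)"

abbreviation vjoin :: "'v ordered_vs \<Rightarrow> 'v \<Rightarrow> 'v \<Rightarrow> 'v" where
  "vjoin V \<equiv> join (vorder V)"

abbreviation vmeet :: "'v ordered_vs \<Rightarrow> 'v \<Rightarrow> 'v \<Rightarrow> 'v" where
  "vmeet V \<equiv> meet (vorder V)"

definition vector_sublattice :: "'v ordered_vs \<Rightarrow> 'v set \<Rightarrow> bool" where
  "vector_sublattice V A \<longleftrightarrow> submodule A real_field V \<and>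
     (\<forall>x\<in>A. \<forall>y\<in>A. vjoin V x y \<in> A \<and> vmeet V x y \<in> A)"

definition generated_vector_sublattice :: "'v ordered_vs \<Rightarrow> 'v set \<Rightarrow> 'v ordered_vs" where
  "generated_vector_sublattice V B = V\<lparr>carrier := vector_sublattice V hull B\<rparr>"

text \<open>
  Homomorphisms are taken to be extensional (\<open>undefined\<close> outside the carrier), so that equality
  of homomorphisms is equality on the carrier.
\<close>

definition vector_lattice_hom :: "'v ordered_vs \<Rightarrow> 'w ordered_vs \<Rightarrow> ('v \<Rightarrow> 'w) set" where
  "vector_lattice_hom V W = {h \<in> carrier V \<rightarrow>\<^sub>E carrier W.
     (\<forall>x\<in>carrier V. \<forall>y\<in>carrier V. h (x \<oplus>\<^bsub>V\<^esub> y) = h x \<oplus>\<^bsub>W\<^esub> h y) \<and>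
     (\<forall>a. \<forall>x\<in>carrier V. h (a \<odot>\<^bsub>V\<^esub> x) = a \<odot>\<^bsub>W\<^esub> h x) \<and>
     (\<forall>x\<in>carrier V. \<forall>y\<in>carrier V. h (vjoin V x y) = vjoin W (h x) (h y)) \<and>
     (\<forall>x\<in>carrier V. \<forall>y\<in>carrier V. h (vmeet V x y) = vmeet W (h x) (h y))}"

text \<open>
  HOL cannot quantify over types inside a definition, so the type of the elements of the test
  objects \<open>G\<close> is a parameter. A statement in which that type is a free type variable
  covers all vector lattices \<open>G\<close>.
\<close>

definition free_vector_lattice ::
    "'g itself \<Rightarrow> 's set \<Rightarrow> ('s \<Rightarrow> 'f) \<Rightarrow> 'f ordered_vs \<Rightarrow> bool" where
  "free_vector_lattice T S j F \<longleftrightarrow> vector_lattice F \<and> j \<in> S \<rightarrow> carrier F \<and>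
     (\<forall>G :: 'g ordered_vs. vector_lattice G \<longrightarrow>
       (\<forall>\<phi> \<in> S \<rightarrow> carrier G.
         \<exists>!h. h \<in> vector_lattice_hom F G \<and> (\<forall>s\<in>S. h (j s) = \<phi> s)))"


section \<open>Vector lattices of functions\<close>

definition Fun :: "'x set \<Rightarrow> ('x \<Rightarrow> real) ordered_vs" where
  "Fun X = \<lparr>carrier = X \<rightarrow>\<^sub>E UNIV, mult = undefined, one = undefined,
     zero = (\<lambda>x\<in>X. 0), add = (\<lambda>f g. \<lambda>x\<in>X. f x + g x),
     smult = (\<lambda>a f. \<lambda>x\<in>X. a * f x), vle = (\<lambda>f g. \<forall>x\<in>X. f x \<le> g x)\<rparr>"

definition Fun00 :: "'s set \<Rightarrow> ('s \<Rightarrow> real) ordered_vs" where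
  "Fun00 S = (Fun S)\<lparr>carrier := {f \<in> carrier (Fun S). finite {s \<in> S. f s \<noteq> 0}}\<rparr>"

definition evaluation :: "'s set \<Rightarrow> 's \<Rightarrow> ('s \<Rightarrow> real) \<Rightarrow> real" where
  "evaluation S s = (\<lambda>f\<in>carrier (Fun00 S). f s)"

end

theory Submission
  imports Defs
begin

text \<open>
  Uniqueness holds because two homomorphisms agree on a vector sublattice. For existence one has
  to show that a lattice-linear expression which vanishes on all of \<open>Fun00 S\<close> vanishes for every
  family in every vector lattice \<open>G\<close>. By distributivity the expression is a finite supremum of
  finite infima of linear forms, and it suffices to see that its value in \<open>G\<close> is \<open>\<le> 0\<close>
  (then apply this to its negative), so only a single infimum \<open>g\<close> needs to be considered. If
  the minimum of the forms is \<open>\<le> 0\<close> everywhere, then by Gordan's alternative some nontrivial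
  nonnegative combination of the forms is zero, and in \<open>G\<close> it dominates a positive multiple of
  \<open>g\<close>. No representation theorem for \<open>G\<close> is needed, so \<open>G\<close> may be non-Archimedean.
\<close>

section \<open>Arithmetic in vector lattices\<close>

lemma real_field_simps [simp]:
  "carrier real_field = UNIV" "a \<otimes>\<^bsub>real_field\<^esub> b = a * b" "\<one>\<^bsub>real_field\<^esub> = 1"
  "\<zero>\<^bsub>real_field\<^esub> = 0" "a \<oplus>\<^bsub>real_field\<^esub> b = a + b"
  by (simp_all add: real_field_def)

lemma cring_real_field: "cring real_field"
proof (rule cringI)
  show "abelian_group real_field"
  proof (rule abelian_groupI)
    fix x :: real
    show "\<exists>y\<in>carrier real_field. y \<oplus>\<^bsub>real_field\<^esub> x = \<zero>\<^bsub>real_field\<^esub>"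
      by (intro bexI[of _ "- x"]) auto
  qed auto
  show "comm_monoid real_field"
    by (rule comm_monoidI) auto
qed (auto simp: algebra_simps)

lemma vorder_simps [simp]:
  "carrier (vorder V) = carrier V" "le (vorder V) = vle V" "eq (vorder V) = (=)"
  by (simp_all add: vorder_def)

text \<open>Replaces least and greatest elements of \<open>Upper\<close> and \<open>Lower\<close>
  sets by elementwise bounds. In this form the axioms are checked for \<open>Fun X\<close> and for
  restricted carriers.\<close>

lemma vector_latticeI:
  assumes "module real_field V"
    and refl: "\<And>x. x \<in> carrier V \<Longrightarrow> vle V x x"
    and antisym: "\<And>x y. \<lbrakk>x \<in> carrier V; y \<in> carrier V; vle V x y; vle V y x\<rbrakk> \<Longrightarrow> x = y"
    and trans: "\<And>x y z. \<lbrakk>x \<in> carrier V; y \<in> carrier V; z \<in> carrier V; vle V x y; vle V y z\<rbrakk>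
      \<Longrightarrow> vle V x z"
    and join: "\<And>x y. \<lbrakk>x \<in> carrier V; y \<in> carrier V\<rbrakk> \<Longrightarrow>
      \<exists>z\<in>carrier V. vle V x z \<and> vle V y z \<and> (\<forall>w\<in>carrier V. vle V x w \<longrightarrow> vle V y w \<longrightarrow> vle V z w)"
    and meet: "\<And>x y. \<lbrakk>x \<in> carrier V; y \<in> carrier V\<rbrakk> \<Longrightarrow>
      \<exists>z\<in>carrier V. vle V z x \<and> vle V z y \<and> (\<forall>w\<in>carrier V. vle V w x \<longrightarrow> vle V w y \<longrightarrow> vle V w z)"
    and "\<And>x y z. \<lbrakk>x \<in> carrier V; y \<in> carrier V; z \<in> carrier V; vle V x y\<rbrakk>
      \<Longrightarrow> vle V (x \<oplus>\<^bsub>V\<^esub> z) (y \<oplus>\<^bsub>V\<^esub> z)"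
    and "\<And>x y a. \<lbrakk>x \<in> carrier V; y \<in> carrier V; 0 \<le> a; vle V x y\<rbrakk>
      \<Longrightarrow> vle V (a \<odot>\<^bsub>V\<^esub> x) (a \<odot>\<^bsub>V\<^esub> y)"
  shows "vector_lattice V"
proof -
  interpret module real_field V by fact
  interpret partial_order "vorder V"
    by unfold_locales (auto intro: refl antisym trans)
  have "lattice (vorder V)"
  proof
    fix x y assume "x \<in> carrier (vorder V)" "y \<in> carrier (vorder V)"
    then have xy: "x \<in> carrier V" "y \<in> carrier V" by simp_all
    from join[OF xy] xy show "\<exists>s. least (vorder V) s (Upper (vorder V) {x, y})"
      by (auto simp: least_def Upper_def)
    from meet[OF xy] xy show "\<exists>s. greatest (vorder V) s (Lower (vorder V) {x, y})"
      by (auto simp: greatest_def Lower_def)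
  qed
  with assms(1,7,8) show ?thesis
    by (auto intro!: vector_lattice.intro vector_lattice_axioms.intro)
qed

context vector_lattice
begin

lemma vle_refl: "x \<in> carrier V \<Longrightarrow> vle V x x"
  using le_refl by simp

lemma vle_trans: "\<lbrakk>vle V x y; vle V y z; x \<in> carrier V; y \<in> carrier V; z \<in> carrier V\<rbrakk> \<Longrightarrow> vle V x z"
  using le_trans by simp

lemma vle_antisym: "\<lbrakk>vle V x y; vle V y x; x \<in> carrier V; y \<in> carrier V\<rbrakk> \<Longrightarrow> x = y"
  using le_antisym by simp

lemma vjoin_closed [simp]: "\<lbrakk>x \<in> carrier V; y \<in> carrier V\<rbrakk> \<Longrightarrow> vjoin V x y \<in> carrier V"
  using join_closed by simp

lemma vmeet_closed [simp]: "\<lbrakk>x \<in> carrier V; y \<in> carrier V\<rbrakk> \<Longrightarrow> vmeet V x y \<in> carrier V"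
  using meet_closed by simp

lemma vjoin_upper:
  assumes "x \<in> carrier V" "y \<in> carrier V"
  shows "vle V x (vjoin V x y)" "vle V y (vjoin V x y)"
  using join_left join_right assms by simp_all

lemma vmeet_lower:
  assumes "x \<in> carrier V" "y \<in> carrier V"
  shows "vle V (vmeet V x y) x" "vle V (vmeet V x y) y"
  using meet_left meet_right assms by simp_all

lemma vjoin_least:
  "\<lbrakk>vle V x z; vle V y z; x \<in> carrier V; y \<in> carrier V; z \<in> carrier V\<rbrakk> \<Longrightarrow> vle V (vjoin V x y) z"
  using join_le by simp

lemma vmeet_greatest:
  "\<lbrakk>vle V z x; vle V z y; x \<in> carrier V; y \<in> carrier V; z \<in> carrier V\<rbrakk> \<Longrightarrow> vle V z (vmeet V x y)"
  using meet_le by simp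

lemma vjoin_eqI:
  assumes "x \<in> carrier V" "y \<in> carrier V" "z \<in> carrier V" "vle V x z" "vle V y z"
    and "\<And>w. \<lbrakk>w \<in> carrier V; vle V x w; vle V y w\<rbrakk> \<Longrightarrow> vle V z w"
  shows "vjoin V x y = z"
  by (intro vle_antisym vjoin_least assms vjoin_upper vjoin_closed)

lemma vmeet_eqI:
  assumes "x \<in> carrier V" "y \<in> carrier V" "z \<in> carrier V" "vle V z x" "vle V z y"
    and "\<And>w. \<lbrakk>w \<in> carrier V; vle V w x; vle V w y\<rbrakk> \<Longrightarrow> vle V w z"
  shows "vmeet V x y = z"
  by (intro vle_antisym vmeet_greatest assms vmeet_lower vmeet_closed)

lemma smult_minus_one: "x \<in> carrier V \<Longrightarrow> (- 1) \<odot>\<^bsub>V\<^esub> x = \<ominus>\<^bsub>V\<^esub> x"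
proof -
  assume x: "x \<in> carrier V"
  have "(- 1) \<odot>\<^bsub>V\<^esub> x \<oplus>\<^bsub>V\<^esub> x = \<zero>\<^bsub>V\<^esub>"
    using smult_l_distr[of "- 1" 1 x] smult_l_null[OF x] smult_one[OF x] x by simp
  with x show ?thesis
    using smult_closed[of "- 1" x] by (simp add: M.minus_equality)
qed

lemma smult_cancel:
  assumes "a \<noteq> 0" "x \<in> carrier V"
  shows "a \<odot>\<^bsub>V\<^esub> (inverse a \<odot>\<^bsub>V\<^esub> x) = x" "inverse a \<odot>\<^bsub>V\<^esub> (a \<odot>\<^bsub>V\<^esub> x) = x"
  using assms smult_assoc1[of a "inverse a" x] smult_assoc1[of "inverse a" a x] smult_one[of x]
  by simp_all

text \<open>Scaling by \<open>- a\<close> is monotone. Translating the resulting inequality by the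
  sum of \<open>a\<close> times \<open>x\<close> and \<open>a\<close> times \<open>y\<close> cancels
  one term on each side and leaves the other two in reversed order.\<close>

lemma vle_neg_smult:
  assumes "x \<in> carrier V" "y \<in> carrier V" "a \<le> 0" "vle V x y"
  shows "vle V (a \<odot>\<^bsub>V\<^esub> y) (a \<odot>\<^bsub>V\<^esub> x)"
proof -
  let ?n = "\<lambda>x. (- a) \<odot>\<^bsub>V\<^esub> x"
  have c [simp]: "b \<odot>\<^bsub>V\<^esub> z \<in> carrier V" if "z \<in> carrier V" for b z
    using that by (simp add: smult_closed)
  have z: "a \<odot>\<^bsub>V\<^esub> z \<oplus>\<^bsub>V\<^esub> ?n z = \<zero>\<^bsub>V\<^esub>" "?n z \<oplus>\<^bsub>V\<^esub> a \<odot>\<^bsub>V\<^esub> z = \<zero>\<^bsub>V\<^esub>"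
    if "z \<in> carrier V" for z
    using that smult_l_distr[of a "- a" z] smult_l_distr[of "- a" a z] smult_l_null[of z] by simp_all
  have "vle V (?n x \<oplus>\<^bsub>V\<^esub> (a \<odot>\<^bsub>V\<^esub> x \<oplus>\<^bsub>V\<^esub> a \<odot>\<^bsub>V\<^esub> y)) (?n y \<oplus>\<^bsub>V\<^esub> (a \<odot>\<^bsub>V\<^esub> x \<oplus>\<^bsub>V\<^esub> a \<odot>\<^bsub>V\<^esub> y))"
    using assms by (intro vle_add vle_smult) auto
  moreover have "?n x \<oplus>\<^bsub>V\<^esub> (a \<odot>\<^bsub>V\<^esub> x \<oplus>\<^bsub>V\<^esub> a \<odot>\<^bsub>V\<^esub> y) = a \<odot>\<^bsub>V\<^esub> y"
    using assms z by (simp add: M.a_assoc[symmetric])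
  moreover have "?n y \<oplus>\<^bsub>V\<^esub> (a \<odot>\<^bsub>V\<^esub> x \<oplus>\<^bsub>V\<^esub> a \<odot>\<^bsub>V\<^esub> y) = a \<odot>\<^bsub>V\<^esub> x"
    using assms z by (simp add: M.a_comm[of "a \<odot>\<^bsub>V\<^esub> x" "a \<odot>\<^bsub>V\<^esub> y"] M.a_assoc[symmetric])
  ultimately show ?thesis by simp
qed

text \<open>Order automorphisms transport extremal bounds: the inverse \<open>g\<close> pulls a
  bound \<open>w\<close> of the images back to a bound of \<open>x\<close> and \<open>y\<close>. The
  intended maps are translations and positive scalings.\<close>

lemma order_iso_vjoin_vmeet:
  assumes f: "f \<in> carrier V \<rightarrow> carrier V" and g: "g \<in> carrier V \<rightarrow> carrier V"
    and fg: "\<And>x. x \<in> carrier V \<Longrightarrow> f (g x) = x" and gf: "\<And>x. x \<in> carrier V \<Longrightarrow> g (f x) = x"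
    and mono_f: "\<And>x y. \<lbrakk>x \<in> carrier V; y \<in> carrier V; vle V x y\<rbrakk> \<Longrightarrow> vle V (f x) (f y)"
    and mono_g: "\<And>x y. \<lbrakk>x \<in> carrier V; y \<in> carrier V; vle V x y\<rbrakk> \<Longrightarrow> vle V (g x) (g y)"
    and xy: "x \<in> carrier V" "y \<in> carrier V"
  shows "f (vjoin V x y) = vjoin V (f x) (f y)" "f (vmeet V x y) = vmeet V (f x) (f y)"
proof -
  have c: "f z \<in> carrier V" "g z \<in> carrier V" if "z \<in> carrier V" for z
    using f g that by auto
  show "f (vjoin V x y) = vjoin V (f x) (f y)"
  proof (rule vjoin_eqI[symmetric])
    fix w assume w: "w \<in> carrier V" "vle V (f x) w" "vle V (f y) w"
    then have "vle V x (g w)" "vle V y (g w)"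
      using mono_g[of "f x" w] mono_g[of "f y" w] xy by (simp_all add: gf c)
    then have "vle V (f (vjoin V x y)) (f (g w))"
      using xy w by (auto intro!: mono_f vjoin_least c)
    then show "vle V (f (vjoin V x y)) w" using w by (simp add: fg)
  qed (use xy in \<open>auto intro!: mono_f vjoin_upper c\<close>)
  show "f (vmeet V x y) = vmeet V (f x) (f y)"
  proof (rule vmeet_eqI[symmetric])
    fix w assume w: "w \<in> carrier V" "vle V w (f x)" "vle V w (f y)"
    then have "vle V (g w) x" "vle V (g w) y"
      using mono_g[of w "f x"] mono_g[of w "f y"] xy by (simp_all add: gf c)
    then have "vle V (f (g w)) (f (vmeet V x y))"
      using xy w by (auto intro!: mono_f vmeet_greatest c)
    then show "vle V w (f (vmeet V x y))" using w by (simp add: fg)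
  qed (use xy in \<open>auto intro!: mono_f vmeet_lower c\<close>)
qed

text \<open>The order-reversing counterpart, intended for negative scalings: pulling back along
  \<open>g\<close> turns lower bounds into upper bounds and conversely.\<close>

lemma order_anti_iso_vjoin_vmeet:
  assumes f: "f \<in> carrier V \<rightarrow> carrier V" and g: "g \<in> carrier V \<rightarrow> carrier V"
    and fg: "\<And>x. x \<in> carrier V \<Longrightarrow> f (g x) = x" and gf: "\<And>x. x \<in> carrier V \<Longrightarrow> g (f x) = x"
    and anti_f: "\<And>x y. \<lbrakk>x \<in> carrier V; y \<in> carrier V; vle V x y\<rbrakk> \<Longrightarrow> vle V (f y) (f x)"
    and anti_g: "\<And>x y. \<lbrakk>x \<in> carrier V; y \<in> carrier V; vle V x y\<rbrakk> \<Longrightarrow> vle V (g y) (g x)"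
    and xy: "x \<in> carrier V" "y \<in> carrier V"
  shows "f (vjoin V x y) = vmeet V (f x) (f y)" "f (vmeet V x y) = vjoin V (f x) (f y)"
proof -
  have c: "f z \<in> carrier V" "g z \<in> carrier V" if "z \<in> carrier V" for z
    using f g that by auto
  show "f (vjoin V x y) = vmeet V (f x) (f y)"
  proof (rule vmeet_eqI[symmetric])
    fix w assume w: "w \<in> carrier V" "vle V w (f x)" "vle V w (f y)"
    then have "vle V x (g w)" "vle V y (g w)"
      using anti_g[of w "f x"] anti_g[of w "f y"] xy by (simp_all add: gf c)
    then have "vle V (f (g w)) (f (vjoin V x y))"
      using xy w by (auto intro!: anti_f vjoin_least c)
    then show "vle V w (f (vjoin V x y))" using w by (simp add: fg)
  qed (use xy in \<open>auto intro!: anti_f vjoin_upper c\<close>)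
  show "f (vmeet V x y) = vjoin V (f x) (f y)"
  proof (rule vjoin_eqI[symmetric])
    fix w assume w: "w \<in> carrier V" "vle V (f x) w" "vle V (f y) w"
    then have "vle V (g w) x" "vle V (g w) y"
      using anti_g[of "f x" w] anti_g[of "f y" w] xy by (simp_all add: gf c)
    then have "vle V (f (vmeet V x y)) (f (g w))"
      using xy w by (auto intro!: anti_f vmeet_greatest c)
    then show "vle V (f (vmeet V x y)) w" using w by (simp add: fg)
  qed (use xy in \<open>auto intro!: anti_f vmeet_lower c\<close>)
qed

lemma vjoin_vmeet_add:
  assumes "x \<in> carrier V" "y \<in> carrier V" "z \<in> carrier V"
  shows "vjoin V x y \<oplus>\<^bsub>V\<^esub> z = vjoin V (x \<oplus>\<^bsub>V\<^esub> z) (y \<oplus>\<^bsub>V\<^esub> z)"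
    "vmeet V x y \<oplus>\<^bsub>V\<^esub> z = vmeet V (x \<oplus>\<^bsub>V\<^esub> z) (y \<oplus>\<^bsub>V\<^esub> z)"
  using order_iso_vjoin_vmeet[of "\<lambda>x. x \<oplus>\<^bsub>V\<^esub> z" "\<lambda>x. x \<oplus>\<^bsub>V\<^esub> \<ominus>\<^bsub>V\<^esub> z" x y] assms
  by (auto simp: M.a_assoc M.l_neg M.r_neg vle_add)

lemma smult_vjoin_vmeet_nonneg:
  assumes "0 \<le> a" "x \<in> carrier V" "y \<in> carrier V"
  shows "a \<odot>\<^bsub>V\<^esub> vjoin V x y = vjoin V (a \<odot>\<^bsub>V\<^esub> x) (a \<odot>\<^bsub>V\<^esub> y)"
    "a \<odot>\<^bsub>V\<^esub> vmeet V x y = vmeet V (a \<odot>\<^bsub>V\<^esub> x) (a \<odot>\<^bsub>V\<^esub> y)"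
proof -
  have "a \<odot>\<^bsub>V\<^esub> vjoin V x y = vjoin V (a \<odot>\<^bsub>V\<^esub> x) (a \<odot>\<^bsub>V\<^esub> y) \<and>
    a \<odot>\<^bsub>V\<^esub> vmeet V x y = vmeet V (a \<odot>\<^bsub>V\<^esub> x) (a \<odot>\<^bsub>V\<^esub> y)"
  proof (cases "a = 0")
    \<comment> \<open>Scaling by zero has no inverse, so the automorphism argument does not apply
      and both sides are computed to be zero.\<close>
    case True
    have null: "0 \<odot>\<^bsub>V\<^esub> z = \<zero>\<^bsub>V\<^esub>" if "z \<in> carrier V" for z
      using smult_l_null[OF that] by simp
    have "vjoin V \<zero>\<^bsub>V\<^esub> \<zero>\<^bsub>V\<^esub> = \<zero>\<^bsub>V\<^esub>" "vmeet V \<zero>\<^bsub>V\<^esub> \<zero>\<^bsub>V\<^esub> = \<zero>\<^bsub>V\<^esub>"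
      by (rule vjoin_eqI vmeet_eqI; auto intro: vle_refl)+
    with True assms show ?thesis by (simp add: null)
  next
    case False
    with order_iso_vjoin_vmeet[of "\<lambda>x. a \<odot>\<^bsub>V\<^esub> x" "\<lambda>x. inverse a \<odot>\<^bsub>V\<^esub> x" x y] assms
    show ?thesis
      by (auto simp: smult_cancel vle_smult smult_closed)
  qed
  then show "a \<odot>\<^bsub>V\<^esub> vjoin V x y = vjoin V (a \<odot>\<^bsub>V\<^esub> x) (a \<odot>\<^bsub>V\<^esub> y)"
    "a \<odot>\<^bsub>V\<^esub> vmeet V x y = vmeet V (a \<odot>\<^bsub>V\<^esub> x) (a \<odot>\<^bsub>V\<^esub> y)" by auto
qed

lemma smult_vjoin_vmeet_neg:
  assumes "a < 0" "x \<in> carrier V" "y \<in> carrier V"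
  shows "a \<odot>\<^bsub>V\<^esub> vjoin V x y = vmeet V (a \<odot>\<^bsub>V\<^esub> x) (a \<odot>\<^bsub>V\<^esub> y)"
    "a \<odot>\<^bsub>V\<^esub> vmeet V x y = vjoin V (a \<odot>\<^bsub>V\<^esub> x) (a \<odot>\<^bsub>V\<^esub> y)"
  using order_anti_iso_vjoin_vmeet[of "\<lambda>x. a \<odot>\<^bsub>V\<^esub> x" "\<lambda>x. inverse a \<odot>\<^bsub>V\<^esub> x" x y] assms
  by (auto simp: smult_cancel vle_neg_smult smult_closed)

text \<open>A general lattice need not be distributive; here translation invariance of the order
  forces it. The substantial part is that every lower bound \<open>w\<close> of \<open>x\<close> and
  \<open>vjoin V y z\<close> lies below the right-hand side.\<close>

lemma vmeet_vjoin_distrib: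
  assumes x: "x \<in> carrier V" and y: "y \<in> carrier V" and z: "z \<in> carrier V"
  shows "vmeet V x (vjoin V y z) = vjoin V (vmeet V x y) (vmeet V x z)" (is "_ = ?u")
proof (rule vmeet_eqI)
  have u: "?u \<in> carrier V" using assms by simp
  then show "?u \<in> carrier V" .
  show "vle V ?u x"
    using assms by (auto intro!: vjoin_least vmeet_lower)
  show "vle V ?u (vjoin V y z)"
    using assms
    by (auto intro!: vjoin_least intro: vle_trans[OF vmeet_lower(2) vjoin_upper(1)]
        vle_trans[OF vmeet_lower(2) vjoin_upper(2)])
  fix w assume w: "w \<in> carrier V" "vle V w x" "vle V w (vjoin V y z)"
  \<comment> \<open>cancel \<open>d = (x \<squnion> s) - x\<close> from \<open>w + d \<le> s \<le> u + d\<close>, where \<open>s = y \<squnion> z\<close>\<close>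
  define s where "s = vjoin V y z"
  define d where "d = vjoin V x s \<oplus>\<^bsub>V\<^esub> \<ominus>\<^bsub>V\<^esub> x"
  have s: "s \<in> carrier V" and d: "d \<in> carrier V" using assms by (auto simp: s_def d_def)
  have xd: "x \<oplus>\<^bsub>V\<^esub> d = vjoin V x s"
    using x s unfolding d_def
    by (simp add: M.a_comm[of "vjoin V x s"] M.a_assoc[symmetric] M.r_neg)
  have "vle V (x \<oplus>\<^bsub>V\<^esub> \<ominus>\<^bsub>V\<^esub> x) d"
    unfolding d_def using x s by (intro vle_add vjoin_upper) auto
  then have d_pos: "vle V \<zero>\<^bsub>V\<^esub> d" using x by (simp add: M.r_neg)
  \<comment> \<open>To be used for \<open>v = y\<close> and \<open>v = z\<close>. Such a
    \<open>v\<close> is below \<open>x + d\<close>, which is the join of \<open>x\<close> and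
    \<open>s\<close>, and below \<open>v + d\<close> since \<open>d\<close> is nonnegative. Hence it
    is below the meet of the two, which is the translate by \<open>d\<close> of
    \<open>vmeet V x v\<close>.\<close>
  have upper: "vle V v (?u \<oplus>\<^bsub>V\<^esub> d)"
    if v: "v \<in> carrier V" "vle V v s" "vle V (vmeet V x v) ?u" for v
  proof -
    have "vle V v (vjoin V x s)"
      by (rule vle_trans[OF v(2) vjoin_upper(2)]) (use x s v in auto)
    moreover have "vle V v (v \<oplus>\<^bsub>V\<^esub> d)"
      using vle_add[OF _ _ v(1) d_pos] d v(1) by (simp add: M.a_comm)
    ultimately have "vle V v (vmeet V (x \<oplus>\<^bsub>V\<^esub> d) (v \<oplus>\<^bsub>V\<^esub> d))"
      using x s d v by (auto simp: xd intro!: vmeet_greatest)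
    also have "vmeet V (x \<oplus>\<^bsub>V\<^esub> d) (v \<oplus>\<^bsub>V\<^esub> d) = vmeet V x v \<oplus>\<^bsub>V\<^esub> d"
      using x d v by (simp add: vjoin_vmeet_add)
    finally show ?thesis
      by (rule vle_trans[OF _ vle_add]) (use x u d v in auto)
  qed
  have s_le: "vle V s (?u \<oplus>\<^bsub>V\<^esub> d)"
  proof -
    have "vle V y s" "vle V z s"
      using y z by (simp_all add: s_def vjoin_upper)
    then have "vle V y (?u \<oplus>\<^bsub>V\<^esub> d)" "vle V z (?u \<oplus>\<^bsub>V\<^esub> d)"
      using assms by (simp_all add: upper vjoin_upper)
    then show ?thesis
      unfolding s_def using y z u d by (intro vjoin_least) auto
  qed
  \<comment> \<open>With \<open>e = w - x\<close>, which is nonpositive, \<open>w + d\<close> equals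
    the join of \<open>x\<close> and \<open>s\<close> translated by \<open>e\<close>, that is, the
    join of \<open>w\<close> and \<open>s + e\<close>. Both of these are below
    \<open>s\<close>.\<close>
  have le_s: "vle V (w \<oplus>\<^bsub>V\<^esub> d) s"
  proof -
    define e where "e = \<ominus>\<^bsub>V\<^esub> x \<oplus>\<^bsub>V\<^esub> w"
    have e: "e \<in> carrier V" using x w by (simp add: e_def)
    have xe: "x \<oplus>\<^bsub>V\<^esub> e = w"
      using x w by (simp add: e_def M.a_assoc[symmetric] M.r_neg)
    have "vle V (w \<oplus>\<^bsub>V\<^esub> \<ominus>\<^bsub>V\<^esub> x) (x \<oplus>\<^bsub>V\<^esub> \<ominus>\<^bsub>V\<^esub> x)"
      using x w by (intro vle_add) auto
    then have "vle V e \<zero>\<^bsub>V\<^esub>"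
      using x w by (simp add: e_def M.r_neg M.a_comm)
    from vle_add[OF _ _ s this] have "vle V (s \<oplus>\<^bsub>V\<^esub> e) s"
      using s e by (simp add: M.a_comm)
    moreover have "w \<oplus>\<^bsub>V\<^esub> d = vjoin V x s \<oplus>\<^bsub>V\<^esub> e"
      using x s w unfolding d_def e_def
      by (simp add: M.a_assoc M.a_comm[of w])
    then have "w \<oplus>\<^bsub>V\<^esub> d = vjoin V w (s \<oplus>\<^bsub>V\<^esub> e)"
      using x s e by (simp add: vjoin_vmeet_add xe)
    ultimately show ?thesis
      using w s e by (auto intro!: vjoin_least simp: s_def)
  qed
  have "vle V (w \<oplus>\<^bsub>V\<^esub> d) (?u \<oplus>\<^bsub>V\<^esub> d)"
    by (rule vle_trans[OF le_s s_le]) (use u d w s in auto)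
  from vle_add[OF _ _ _ this, of "\<ominus>\<^bsub>V\<^esub> d"] show "vle V w ?u"
    using u d w by (simp add: M.a_assoc M.r_neg)
qed (use assms in auto)

end


section \<open>Vector sublattices\<close>

lemma (in vector_lattice) vector_sublatticeI:
  assumes "A \<subseteq> carrier V" "\<zero>\<^bsub>V\<^esub> \<in> A"
    and "\<And>x y. \<lbrakk>x \<in> A; y \<in> A\<rbrakk> \<Longrightarrow> x \<oplus>\<^bsub>V\<^esub> y \<in> A"
    and smult: "\<And>a x. x \<in> A \<Longrightarrow> a \<odot>\<^bsub>V\<^esub> x \<in> A"
    and "\<And>x y. \<lbrakk>x \<in> A; y \<in> A\<rbrakk> \<Longrightarrow> vjoin V x y \<in> A"
    and "\<And>x y. \<lbrakk>x \<in> A; y \<in> A\<rbrakk> \<Longrightarrow> vmeet V x y \<in> A"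
  shows "vector_sublattice V A"
  unfolding vector_sublattice_def
proof
  show "submodule A real_field V"
  proof (rule submoduleI)
    fix x assume "x \<in> A"
    then show "\<ominus>\<^bsub>V\<^esub> x \<in> A"
      using smult[of x "- 1"] assms(1) by (auto simp: smult_minus_one)
  qed (use assms in auto)
qed (use assms in auto)

lemma vector_sublatticeD:
  assumes "vector_sublattice V A"
  shows "submodule A real_field V"
    and "\<And>x y. \<lbrakk>x \<in> A; y \<in> A\<rbrakk> \<Longrightarrow> x \<oplus>\<^bsub>V\<^esub> y \<in> A"
    and "\<And>a x. x \<in> A \<Longrightarrow> a \<odot>\<^bsub>V\<^esub> x \<in> A"
    and "\<And>x y. \<lbrakk>x \<in> A; y \<in> A\<rbrakk> \<Longrightarrow> vjoin V x y \<in> A"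
    and "\<And>x y. \<lbrakk>x \<in> A; y \<in> A\<rbrakk> \<Longrightarrow> vmeet V x y \<in> A"
    and "A \<subseteq> carrier V" and "\<zero>\<^bsub>V\<^esub> \<in> A"
proof -
  show sub: "submodule A real_field V"
    and "\<And>x y. \<lbrakk>x \<in> A; y \<in> A\<rbrakk> \<Longrightarrow> vjoin V x y \<in> A"
    and "\<And>x y. \<lbrakk>x \<in> A; y \<in> A\<rbrakk> \<Longrightarrow> vmeet V x y \<in> A"
    using assms by (auto simp: vector_sublattice_def)
  interpret submodule A real_field V by (rule sub)
  show "\<And>x y. \<lbrakk>x \<in> A; y \<in> A\<rbrakk> \<Longrightarrow> x \<oplus>\<^bsub>V\<^esub> y \<in> A" "A \<subseteq> carrier V" "\<zero>\<^bsub>V\<^esub> \<in> A"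
    "\<And>a x. x \<in> A \<Longrightarrow> a \<odot>\<^bsub>V\<^esub> x \<in> A"
    using m_closed subset one_closed smult_closed by auto
qed

context vector_lattice
begin

lemma vector_sublattice_carrier: "vector_sublattice V (carrier V)"
  by (rule vector_sublatticeI) (auto simp: smult_closed)

text \<open>The hull is an intersection of sublattices, so the closure properties pass to it. Since
  \<open>B\<close> lies in the carrier, the whole carrier is one of the intersected sets, which
  bounds the hull.\<close>

lemma vector_sublattice_hull:
  assumes "B \<subseteq> carrier V"
  shows "vector_sublattice V (vector_sublattice V hull B)"
proof (rule vector_sublatticeI)
  show "vector_sublattice V hull B \<subseteq> carrier V"
    by (rule hull_minimal) (auto simp: assms vector_sublattice_carrier)
qed (auto simp: hull_def dest: vector_sublatticeD)

lemma vector_sublattice_is_vector_lattice: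
  assumes "vector_sublattice V A"
  shows "vector_lattice (V\<lparr>carrier := A\<rparr>)"
proof (rule vector_latticeI)
  note A = vector_sublatticeD[OF assms]
  have sub: "x \<in> carrier V" if "x \<in> A" for x using that A(6) by auto
  show "module real_field (V\<lparr>carrier := A\<rparr>)"
    using A(1) module_axioms by (rule submodule.submodule_is_module)
  fix x y assume "x \<in> carrier (V\<lparr>carrier := A\<rparr>)" "y \<in> carrier (V\<lparr>carrier := A\<rparr>)"
  then have xy: "x \<in> A" "y \<in> A" by simp_all
  show "\<exists>z\<in>carrier (V\<lparr>carrier := A\<rparr>). vle (V\<lparr>carrier := A\<rparr>) x z \<and> vle (V\<lparr>carrier := A\<rparr>) y z \<and>
      (\<forall>w\<in>carrier (V\<lparr>carrier := A\<rparr>). vle (V\<lparr>carrier := A\<rparr>) x w \<longrightarrow> vle (V\<lparr>carrier := A\<rparr>) y w \<longrightarrow>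
        vle (V\<lparr>carrier := A\<rparr>) z w)"
    using xy A(4)[OF xy] by (intro bexI[of _ "vjoin V x y"]) (auto simp: sub vjoin_upper vjoin_least)
  show "\<exists>z\<in>carrier (V\<lparr>carrier := A\<rparr>). vle (V\<lparr>carrier := A\<rparr>) z x \<and> vle (V\<lparr>carrier := A\<rparr>) z y \<and>
      (\<forall>w\<in>carrier (V\<lparr>carrier := A\<rparr>). vle (V\<lparr>carrier := A\<rparr>) w x \<longrightarrow> vle (V\<lparr>carrier := A\<rparr>) w y \<longrightarrow>
        vle (V\<lparr>carrier := A\<rparr>) w z)"
    using xy A(5)[OF xy] by (intro bexI[of _ "vmeet V x y"]) (auto simp: sub vmeet_lower vmeet_greatest)
qed (use vector_sublatticeD(6)[OF assms] in
    \<open>auto intro: vle_refl vle_antisym vle_trans vle_add vle_smult\<close>)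

text \<open>Restricting the carrier could change extremal bounds, as there are fewer competitors.
  Here the ambient join and meet lie in \<open>A\<close>, so they remain extremal among the bounds
  in \<open>A\<close>.\<close>

lemma vjoin_vmeet_sublattice:
  assumes "vector_sublattice V A" "x \<in> A" "y \<in> A"
  shows "vjoin (V\<lparr>carrier := A\<rparr>) x y = vjoin V x y" "vmeet (V\<lparr>carrier := A\<rparr>) x y = vmeet V x y"
proof -
  note A = vector_sublatticeD[OF assms(1)]
  interpret sub: vector_lattice "V\<lparr>carrier := A\<rparr>"
    using assms(1) by (rule vector_sublattice_is_vector_lattice)
  have sub: "x \<in> carrier V" if "x \<in> A" for x using that A(6) by auto
  show "vjoin (V\<lparr>carrier := A\<rparr>) x y = vjoin V x y"
    using assms A by (intro sub.vjoin_eqI) (auto simp: sub vjoin_upper vjoin_least)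
  show "vmeet (V\<lparr>carrier := A\<rparr>) x y = vmeet V x y"
    using assms A by (intro sub.vmeet_eqI) (auto simp: sub vmeet_lower vmeet_greatest)
qed

end


section \<open>Vector lattices of functions\<close>

lemma Fun_simps [simp]:
  "carrier (Fun X) = X \<rightarrow>\<^sub>E UNIV" "\<zero>\<^bsub>Fun X\<^esub> = (\<lambda>x\<in>X. 0)"
  "f \<oplus>\<^bsub>Fun X\<^esub> g = (\<lambda>x\<in>X. f x + g x)" "a \<odot>\<^bsub>Fun X\<^esub> f = (\<lambda>x\<in>X. a * f x)"
  "vle (Fun X) f g \<longleftrightarrow> (\<forall>x\<in>X. f x \<le> g x)"
  by (simp_all add: Fun_def)

lemma vector_lattice_Fun: "vector_lattice (Fun X)"
proof (rule vector_latticeI)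
  have "abelian_group (Fun X)"
  proof (rule abelian_groupI)
    fix f assume "f \<in> carrier (Fun X)"
    then show "\<exists>g\<in>carrier (Fun X). g \<oplus>\<^bsub>Fun X\<^esub> f = \<zero>\<^bsub>Fun X\<^esub>"
      by (intro bexI[of _ "\<lambda>x\<in>X. - f x"]) (auto simp: restrict_def)
  qed (auto simp: fun_eq_iff algebra_simps PiE_iff extensional_def)
  then show "module real_field (Fun X)"
    using cring_real_field
    by (intro moduleI)
      (auto simp: fun_eq_iff algebra_simps PiE_iff extensional_def)
  fix f g assume "f \<in> carrier (Fun X)" "g \<in> carrier (Fun X)"
  then show "\<exists>h\<in>carrier (Fun X). vle (Fun X) f h \<and> vle (Fun X) g h \<and>
      (\<forall>w\<in>carrier (Fun X). vle (Fun X) f w \<longrightarrow> vle (Fun X) g w \<longrightarrow> vle (Fun X) h w)"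
    by (intro bexI[of _ "\<lambda>x\<in>X. max (f x) (g x)"]) auto
  show "\<exists>h\<in>carrier (Fun X). vle (Fun X) h f \<and> vle (Fun X) h g \<and>
      (\<forall>w\<in>carrier (Fun X). vle (Fun X) w f \<longrightarrow> vle (Fun X) w g \<longrightarrow> vle (Fun X) w h)"
    by (intro bexI[of _ "\<lambda>x\<in>X. min (f x) (g x)"]) auto
next
  fix f g assume "f \<in> carrier (Fun X)" "g \<in> carrier (Fun X)" "vle (Fun X) f g" "vle (Fun X) g f"
  then show "f = g"
    by (intro extensionalityI[of f X g]) (auto simp: PiE_iff intro: order.antisym)
next
  fix f g h assume "vle (Fun X) f g" "vle (Fun X) g h"
  then show "vle (Fun X) f h" by (auto intro: order_trans)
qed (auto intro: mult_left_mono)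

lemma vjoin_vmeet_Fun:
  assumes "f \<in> carrier (Fun X)" "g \<in> carrier (Fun X)"
  shows "vjoin (Fun X) f g = (\<lambda>x\<in>X. max (f x) (g x))" "vmeet (Fun X) f g = (\<lambda>x\<in>X. min (f x) (g x))"
proof -
  interpret vector_lattice "Fun X" by (rule vector_lattice_Fun)
  show "vjoin (Fun X) f g = (\<lambda>x\<in>X. max (f x) (g x))"
    using assms by (intro vjoin_eqI) auto
  show "vmeet (Fun X) f g = (\<lambda>x\<in>X. min (f x) (g x))"
    using assms by (intro vmeet_eqI) auto
qed


section \<open>Elimination of variables\<close>

text \<open>Supplies the value of the eliminated variable below. By finiteness there is a genuine
  gap between \<open>Max L\<close> and \<open>Min U\<close>; if one set is empty, a unit step beyond
  the extremum of the other suffices.\<close>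

lemma finite_strict_separation:
  fixes L U :: "real set"
  assumes "finite L" "finite U" "\<And>l u. \<lbrakk>l \<in> L; u \<in> U\<rbrakk> \<Longrightarrow> l < u"
  shows "\<exists>t. (\<forall>l\<in>L. l < t) \<and> (\<forall>u\<in>U. t < u)"
proof (cases "L = {}")
  case True
  show ?thesis
  proof (cases "U = {}")
    case False
    then show ?thesis
      using True Min_le[OF assms(2)] by (intro exI[of _ "Min U - 1"]) force
  qed (use True in auto)
next
  case L: False
  show ?thesis
  proof (cases "U = {}")
    case True
    then show ?thesis
      using L Max_ge[OF assms(1)] by (intro exI[of _ "Max L + 1"]) force
  next
    case False
    then have "Max L < Min U"
      using L assms by simp
    then obtain t where "Max L < t" "t < Min U"
      using dense by blast
    then show ?thesis
      using L False assms(1,2) by auto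
  qed
qed

text \<open>
  A conic form of Gordan's alternative, proved by Fourier--Motzkin elimination: forms with
  coefficients of opposite sign at the eliminated variable are combined so as to cancel it.
\<close>

lemma cone_meets_kernel:
  fixes A K :: "('s \<Rightarrow> real) set"
  assumes "finite V" "finite A" "A \<noteq> {}" "A \<subseteq> K"
    and add: "\<And>k l. \<lbrakk>k \<in> K; l \<in> K\<rbrakk> \<Longrightarrow> (\<lambda>s. k s + l s) \<in> K"
    and scale: "\<And>r k. \<lbrakk>0 < r; k \<in> K\<rbrakk> \<Longrightarrow> (\<lambda>s. r * k s) \<in> K"
    and "\<And>x. \<exists>c\<in>A. (\<Sum>s\<in>V. c s * x s) \<le> 0"
  shows "\<exists>k\<in>K. \<forall>s\<in>V. k s = 0"
  using assms(1-4,7) add scale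
proof (induction V arbitrary: A K rule: finite_induct)
  case empty
  then show ?case by auto
next
  case (insert v V)
  note add = insert.prems(5) and scale = insert.prems(6)
  \<comment> \<open>For \<open>c\<close> in \<open>P\<close> and \<open>d\<close> in
    \<open>N\<close> both multipliers are positive, so the combination stays in the cone, and its
    coefficient at \<open>v\<close> cancels.\<close>
  define comb where "comb c d = (\<lambda>s. (- d v) * c s + c v * d s)" for c d :: "'s \<Rightarrow> real"
  define P N Z where "P = {c \<in> A. 0 < c v}" and "N = {c \<in> A. c v < 0}" and "Z = {c \<in> A. c v = 0}"
  define B where "B = Z \<union> (\<lambda>(c, d). comb c d) ` (P \<times> N)"
  \<comment> \<open>The induction hypothesis is applied to this smaller cone, so that the function
    it yields vanishes at \<open>v\<close> as well as on \<open>V\<close>.\<close>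
  define K' where "K' = {k \<in> K. k v = 0}"
  have fin: "finite P" "finite N" "finite Z" "finite B"
    using insert.prems(1) by (auto simp: P_def N_def Z_def B_def)
  have A: "A = P \<union> N \<union> Z" by (auto simp: P_def N_def Z_def)
  have comb: "comb c d \<in> K'" if "c \<in> P" "d \<in> N" for c d
    using that insert.prems(3) add[OF scale[of "- d v" c] scale[of "c v" d]]
    by (auto simp: P_def N_def K'_def comb_def)
  have BK: "B \<subseteq> K'"
    using comb insert.prems(3) by (auto simp: B_def Z_def K'_def)
  have B_le: "\<exists>c\<in>B. (\<Sum>s\<in>V. c s * y s) \<le> 0" for y :: "'s \<Rightarrow> real"
  proof (rule ccontr)
    assume "\<not> (\<exists>c\<in>B. (\<Sum>s\<in>V. c s * y s) \<le> 0)"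
    then have pos: "0 < (\<Sum>s\<in>V. c s * y s)" if "c \<in> B" for c
      using that by force
    define e where "e c = (\<Sum>s\<in>V. c s * y s)" for c :: "'s \<Rightarrow> real"
    \<comment> \<open>If \<open>y\<close> is given the value \<open>t\<close> at \<open>v\<close>, a
      form \<open>c\<close> takes the value \<open>c v * t + e c\<close>. Positivity is a lower
      bound on \<open>t\<close> for \<open>c\<close> in \<open>P\<close> and an upper bound for
      \<open>c\<close> in \<open>N\<close>; positivity of the combinations says that these bounds
      are compatible.\<close>
    have "\<exists>t. (\<forall>c\<in>P. - e c / c v < t) \<and> (\<forall>d\<in>N. t < e d / (- d v))"
    proof -
      have "\<forall>l\<in>(\<lambda>c. - e c / c v) ` P. \<forall>u\<in>(\<lambda>d. e d / (- d v)) ` N. l < u"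
      proof clarify
        fix c d assume cd: "c \<in> P" "d \<in> N"
        then have "comb c d \<in> B" by (auto simp: B_def)
        from pos[OF this] have "0 < (- d v) * e c + c v * e d"
          by (simp add: comb_def e_def sum_distrib_left algebra_simps sum.distrib sum_subtractf sum_negf)
        then show "- e c / c v < e d / (- d v)"
          using cd by (simp add: P_def N_def field_simps)
      qed
      then have "\<exists>t. (\<forall>l\<in>(\<lambda>c. - e c / c v) ` P. l < t) \<and> (\<forall>u\<in>(\<lambda>d. e d / (- d v)) ` N. t < u)"
        using fin by (intro finite_strict_separation) auto
      then show ?thesis by auto
    qed
    then obtain t where t: "\<And>c. c \<in> P \<Longrightarrow> - e c / c v < t" "\<And>d. d \<in> N \<Longrightarrow> t < e d / (- d v)"
      by auto
    define x where "x = y(v := t)"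
    have x: "(\<Sum>s\<in>insert v V. c s * x s) = c v * t + e c" for c
    proof -
      have "(\<Sum>s\<in>V. c s * x s) = e c"
        unfolding e_def using insert.hyps by (intro sum.cong) (auto simp: x_def)
      then show ?thesis using insert.hyps by (simp add: x_def)
    qed
    have "0 < c v * t + e c" if "c \<in> A" for c
      using that unfolding A
    proof (elim UnE)
      assume "c \<in> P"
      with t(1)[OF this] show ?thesis by (simp add: P_def field_simps)
    next
      assume "c \<in> N"
      with t(2)[OF this] show ?thesis by (simp add: N_def field_simps)
    next
      assume "c \<in> Z"
      with pos[of c] show ?thesis by (simp add: Z_def B_def e_def)
    qed
    with insert.prems(4)[of x] x show False by force
  qed
  \<comment> \<open>Nonemptiness of \<open>A\<close> would not be enough, for instance if
    \<open>A = P\<close>. The bound just proved supplies an element of \<open>B\<close> at any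
    point.\<close>
  have B_ne: "B \<noteq> {}"
    using B_le[of "\<lambda>_. 0"] by auto
  have "\<exists>k\<in>K'. \<forall>s\<in>V. k s = 0"
    by (rule insert.IH[OF fin(4) B_ne BK B_le]) (auto simp: K'_def add scale)
  then show ?case by (auto simp: K'_def)
qed


section \<open>The graph of the extension\<close>

locale vector_lattice_family = vector_lattice G for G :: "'g ordered_vs" +
  fixes S :: "'s set" and \<phi> :: "'s \<Rightarrow> 'g"
  assumes family: "\<phi> \<in> S \<rightarrow> carrier G"
begin

section \<open>Linear forms on \<open>X\<close> and the matching linear combinations in
  \<open>G\<close>\<close>

abbreviation X :: "('s \<Rightarrow> real) set" where "X \<equiv> carrier (Fun00 S)"

text \<open>Coefficient families are total functions that vanish outside \<open>S\<close>, unlike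
  the extensional points of \<open>X\<close>. Sums and multiples of them therefore need no
  restriction to \<open>S\<close>.\<close>

definition finsupp :: "('s \<Rightarrow> real) \<Rightarrow> bool" where
  "finsupp c \<longleftrightarrow> finite {s. c s \<noteq> 0} \<and> {s. c s \<noteq> 0} \<subseteq> S"

definition lin :: "('s \<Rightarrow> real) \<Rightarrow> 'g" where
  "lin c = (\<Oplus>\<^bsub>G\<^esub>s\<in>{s. c s \<noteq> 0}. c s \<odot>\<^bsub>G\<^esub> \<phi> s)"

definition form :: "('s \<Rightarrow> real) \<Rightarrow> ('s \<Rightarrow> real) \<Rightarrow> real" where
  "form c = (\<lambda>x\<in>X. \<Sum>s | c s \<noteq> 0. c s * x s)"

lemma finsupp_add:
  assumes "finsupp c" "finsupp d"
  shows "finsupp (\<lambda>s. c s + d s)"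
proof -
  have "{s. c s + d s \<noteq> 0} \<subseteq> {s. c s \<noteq> 0} \<union> {s. d s \<noteq> 0}" by auto
  with assms show ?thesis
    unfolding finsupp_def by (meson finite_UnI finite_subset le_sup_iff order_trans)
qed

lemma finsupp_scale: "finsupp c \<Longrightarrow> finsupp (\<lambda>s. a * c s)"
  by (cases "a = 0") (auto simp: finsupp_def)

lemma family_closed: "s \<in> S \<Longrightarrow> \<phi> s \<in> carrier G"
  using family by auto

text \<open>The support changes under sums and multiples; padding with zero terms lets all families
  involved be summed over one common finite set.\<close>

lemma lin_eq_finsum:
  assumes "finite V" "{s. c s \<noteq> 0} \<subseteq> V" "V \<subseteq> S"
  shows "lin c = (\<Oplus>\<^bsub>G\<^esub>s\<in>V. c s \<odot>\<^bsub>G\<^esub> \<phi> s)"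
  unfolding lin_def
proof (rule M.add.finprod_mono_neutral_cong_left)
  fix s assume "s \<in> V - {s. c s \<noteq> 0}"
  then show "c s \<odot>\<^bsub>G\<^esub> \<phi> s = \<zero>\<^bsub>G\<^esub>"
    using assms smult_l_null[of "\<phi> s"] by (auto simp: family_closed)
next
  show "(\<lambda>s. c s \<odot>\<^bsub>G\<^esub> \<phi> s) \<in> V \<rightarrow> carrier G"
    using assms by (auto simp: family_closed smult_closed)
qed (use assms in auto)

lemma form_eq_sum:
  assumes "finite V" "{s. c s \<noteq> 0} \<subseteq> V" "x \<in> X"
  shows "form c x = (\<Sum>s\<in>V. c s * x s)"
  unfolding form_def using assms by (auto intro!: sum.mono_neutral_left)

lemma lin_closed [simp]: "finsupp c \<Longrightarrow> lin c \<in> carrier G"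
  unfolding lin_def finsupp_def
  by (rule M.finsum_closed) (auto simp: family_closed smult_closed)

lemma lin_add:
  assumes c: "finsupp c" and d: "finsupp d"
  shows "lin (\<lambda>s. c s + d s) = lin c \<oplus>\<^bsub>G\<^esub> lin d"
proof -
  let ?V = "{s. c s \<noteq> 0} \<union> {s. d s \<noteq> 0}"
  have V: "finite ?V" "?V \<subseteq> S" using c d by (auto simp: finsupp_def)
  have "lin (\<lambda>s. c s + d s) = (\<Oplus>\<^bsub>G\<^esub>s\<in>?V. (c s + d s) \<odot>\<^bsub>G\<^esub> \<phi> s)"
    using V by (intro lin_eq_finsum) auto
  also have "\<dots> = (\<Oplus>\<^bsub>G\<^esub>s\<in>?V. c s \<odot>\<^bsub>G\<^esub> \<phi> s \<oplus>\<^bsub>G\<^esub> d s \<odot>\<^bsub>G\<^esub> \<phi> s)"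
  proof (rule M.finsum_cong')
    fix s assume "s \<in> ?V"
    then show "(c s + d s) \<odot>\<^bsub>G\<^esub> \<phi> s = c s \<odot>\<^bsub>G\<^esub> \<phi> s \<oplus>\<^bsub>G\<^esub> d s \<odot>\<^bsub>G\<^esub> \<phi> s"
      using V smult_l_distr[of "c s" "d s" "\<phi> s"] by (auto simp: family_closed)
  qed (use V in \<open>auto simp: family_closed smult_closed subset_iff\<close>)
  also have "\<dots> = (\<Oplus>\<^bsub>G\<^esub>s\<in>?V. c s \<odot>\<^bsub>G\<^esub> \<phi> s) \<oplus>\<^bsub>G\<^esub> (\<Oplus>\<^bsub>G\<^esub>s\<in>?V. d s \<odot>\<^bsub>G\<^esub> \<phi> s)"
    using V by (intro M.finsum_addf) (auto simp: family_closed smult_closed subset_iff)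
  also have "\<dots> = lin c \<oplus>\<^bsub>G\<^esub> lin d"
    using V by (simp add: lin_eq_finsum[of ?V c] lin_eq_finsum[of ?V d])
  finally show ?thesis .
qed

lemma lin_scale:
  assumes c: "finsupp c"
  shows "lin (\<lambda>s. a * c s) = a \<odot>\<^bsub>G\<^esub> lin c"
proof -
  let ?V = "{s. c s \<noteq> 0}"
  have V: "finite ?V" "?V \<subseteq> S" using c by (auto simp: finsupp_def)
  have "lin (\<lambda>s. a * c s) = (\<Oplus>\<^bsub>G\<^esub>s\<in>?V. (a * c s) \<odot>\<^bsub>G\<^esub> \<phi> s)"
    using V by (intro lin_eq_finsum) auto
  also have "\<dots> = (\<Oplus>\<^bsub>G\<^esub>s\<in>?V. a \<odot>\<^bsub>G\<^esub> (c s \<odot>\<^bsub>G\<^esub> \<phi> s))"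
  proof (rule M.finsum_cong')
    fix s assume "s \<in> ?V"
    then show "(a * c s) \<odot>\<^bsub>G\<^esub> \<phi> s = a \<odot>\<^bsub>G\<^esub> (c s \<odot>\<^bsub>G\<^esub> \<phi> s)"
      using V smult_assoc1[of a "c s" "\<phi> s"] by (auto simp: family_closed)
  qed (use V in \<open>auto simp: family_closed smult_closed subset_iff\<close>)
  also have "\<dots> = a \<odot>\<^bsub>G\<^esub> lin c"
    unfolding lin_def using V
    by (intro finsum_smult_ldistr[symmetric]) (auto simp: family_closed smult_closed subset_iff)
  finally show ?thesis .
qed

lemma form_add:
  assumes c: "finsupp c" and d: "finsupp d"
  shows "form (\<lambda>s. c s + d s) = (\<lambda>x\<in>X. form c x + form d x)"
proof
  fix x
  let ?V = "{s. c s \<noteq> 0} \<union> {s. d s \<noteq> 0}"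
  have V: "finite ?V" using c d by (auto simp: finsupp_def)
  show "form (\<lambda>s. c s + d s) x = (\<lambda>x\<in>X. form c x + form d x) x"
  proof (cases "x \<in> X")
    case True
    have "form (\<lambda>s. c s + d s) x = (\<Sum>s\<in>?V. (c s + d s) * x s)"
      using V True by (intro form_eq_sum) auto
    with V True show ?thesis
      by (simp add: form_eq_sum[of ?V c] form_eq_sum[of ?V d] distrib_right sum.distrib)
  qed (simp add: form_def)
qed

lemma form_scale:
  assumes c: "finsupp c"
  shows "form (\<lambda>s. a * c s) = (\<lambda>x\<in>X. a * form c x)"
proof
  fix x
  let ?V = "{s. c s \<noteq> 0}"
  have V: "finite ?V" using c by (auto simp: finsupp_def)
  show "form (\<lambda>s. a * c s) x = (\<lambda>x\<in>X. a * form c x) x"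
  proof (cases "x \<in> X")
    case True
    have "form (\<lambda>s. a * c s) x = (\<Sum>s\<in>?V. (a * c s) * x s)"
      using V True by (intro form_eq_sum) auto
    with V True show ?thesis
      by (simp add: form_eq_sum[of ?V c] sum_distrib_left mult.assoc)
  qed (simp add: form_def)
qed

lemma lin_single:
  assumes "s \<in> S"
  shows "lin (\<lambda>t. if t = s then 1 else 0) = \<phi> s"
  using assms smult_one[of "\<phi> s"] by (simp add: lin_def family_closed)

lemma form_single: "form (\<lambda>t. if t = s then 1 else 0) = evaluation S s"
  by (auto simp: form_def evaluation_def fun_eq_iff)

text \<open>
  \<open>graph f g\<close> means that \<open>f\<close> and \<open>g\<close> are the values of one lattice-linear expression in the
  coordinate functions and in the family \<open>\<phi>\<close>, respectively.
\<close>

inductive graph :: "(('s \<Rightarrow> real) \<Rightarrow> real) \<Rightarrow> 'g \<Rightarrow> bool" where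
  linear: "finsupp c \<Longrightarrow> graph (form c) (lin c)"
| join: "\<lbrakk>graph f g; graph f' g'\<rbrakk> \<Longrightarrow> graph (\<lambda>x\<in>X. max (f x) (f' x)) (vjoin G g g')"
| meet: "\<lbrakk>graph f g; graph f' g'\<rbrakk> \<Longrightarrow> graph (\<lambda>x\<in>X. min (f x) (f' x)) (vmeet G g g')"

inductive meet_graph :: "(('s \<Rightarrow> real) \<Rightarrow> real) \<Rightarrow> 'g \<Rightarrow> bool" where
  linear: "finsupp c \<Longrightarrow> meet_graph (form c) (lin c)"
| meet: "\<lbrakk>meet_graph f g; meet_graph f' g'\<rbrakk> \<Longrightarrow>
    meet_graph (\<lambda>x\<in>X. min (f x) (f' x)) (vmeet G g g')"

text \<open>The normal form of a lattice-linear expression: a finite supremum of finite infima of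
  linear forms, evaluated simultaneously on \<open>X\<close> and in \<open>G\<close>.\<close>

inductive join_meet_graph :: "(('s \<Rightarrow> real) \<Rightarrow> real) \<Rightarrow> 'g \<Rightarrow> bool" where
  meets: "meet_graph f g \<Longrightarrow> join_meet_graph f g"
| join: "\<lbrakk>join_meet_graph f g; join_meet_graph f' g'\<rbrakk> \<Longrightarrow>
    join_meet_graph (\<lambda>x\<in>X. max (f x) (f' x)) (vjoin G g g')"

lemma graph_closed: "graph f g \<Longrightarrow> f \<in> extensional X \<and> g \<in> carrier G"
  by (induction rule: graph.induct) (auto simp: form_def extensional_def)

lemma meet_graph_closed: "meet_graph f g \<Longrightarrow> f \<in> extensional X \<and> g \<in> carrier G"
  by (induction rule: meet_graph.induct) (auto simp: form_def extensional_def)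

lemma join_meet_graph_closed: "join_meet_graph f g \<Longrightarrow> f \<in> extensional X \<and> g \<in> carrier G"
  by (induction rule: join_meet_graph.induct) (auto simp: extensional_def dest: meet_graph_closed)

section \<open>Closure of the graph under the vector space operations\<close>

text \<open>The rules of \<open>graph\<close> admit sums only inside linear forms. Translations
  distribute over joins and meets, so a sum can be pushed down to the forms: the outer induction
  decomposes the first summand, and once that is linear, an inner induction decomposes the
  second.\<close>

lemma graph_add:
  assumes "graph f g" "graph f' g'"
  shows "graph (\<lambda>x\<in>X. f x + f' x) (g \<oplus>\<^bsub>G\<^esub> g')"
  using assms
proof (induction arbitrary: f' g' rule: graph.induct)
  case (linear c)
  note c = linear.hyps
  from linear.prems show ?case
  proof (induction rule: graph.induct)
    case (linear d)
    then show ?case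
      using graph.linear[OF finsupp_add[OF c linear]] c by (simp add: form_add lin_add del: restrict_apply)
  next
    case (join f g f' g')
    have "(\<lambda>x\<in>X. form c x + (\<lambda>x\<in>X. max (f x) (f' x)) x) =
        (\<lambda>x\<in>X. max ((\<lambda>x\<in>X. form c x + f x) x) ((\<lambda>x\<in>X. form c x + f' x) x))"
      by (auto simp: fun_eq_iff)
    moreover have "lin c \<oplus>\<^bsub>G\<^esub> vjoin G g g' = vjoin G (lin c \<oplus>\<^bsub>G\<^esub> g) (lin c \<oplus>\<^bsub>G\<^esub> g')"
      using c join.hyps[THEN graph_closed] by (simp add: M.a_comm[of "lin c"] vjoin_vmeet_add)
    ultimately show ?case
      using graph.join[OF join.IH] by (simp del: restrict_apply)
  next
    case (meet f g f' g')
    have "(\<lambda>x\<in>X. form c x + (\<lambda>x\<in>X. min (f x) (f' x)) x) =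
        (\<lambda>x\<in>X. min ((\<lambda>x\<in>X. form c x + f x) x) ((\<lambda>x\<in>X. form c x + f' x) x))"
      by (auto simp: fun_eq_iff)
    moreover have "lin c \<oplus>\<^bsub>G\<^esub> vmeet G g g' = vmeet G (lin c \<oplus>\<^bsub>G\<^esub> g) (lin c \<oplus>\<^bsub>G\<^esub> g')"
      using c meet.hyps[THEN graph_closed] by (simp add: M.a_comm[of "lin c"] vjoin_vmeet_add)
    ultimately show ?case
      using graph.meet[OF meet.IH] by (simp del: restrict_apply)
  qed
next
  case (join f1 g1 f2 g2)
  have "(\<lambda>x\<in>X. (\<lambda>x\<in>X. max (f1 x) (f2 x)) x + f' x) =
      (\<lambda>x\<in>X. max ((\<lambda>x\<in>X. f1 x + f' x) x) ((\<lambda>x\<in>X. f2 x + f' x) x))"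
    by (auto simp: fun_eq_iff)
  moreover have "vjoin G g1 g2 \<oplus>\<^bsub>G\<^esub> g' = vjoin G (g1 \<oplus>\<^bsub>G\<^esub> g') (g2 \<oplus>\<^bsub>G\<^esub> g')"
    using join.hyps[THEN graph_closed] join.prems[THEN graph_closed] by (simp add: vjoin_vmeet_add)
  ultimately show ?case
    using graph.join[OF join.IH(1)[OF join.prems] join.IH(2)[OF join.prems]] by (simp del: restrict_apply)
next
  case (meet f1 g1 f2 g2)
  have "(\<lambda>x\<in>X. (\<lambda>x\<in>X. min (f1 x) (f2 x)) x + f' x) =
      (\<lambda>x\<in>X. min ((\<lambda>x\<in>X. f1 x + f' x) x) ((\<lambda>x\<in>X. f2 x + f' x) x))"
    by (auto simp: fun_eq_iff)
  moreover have "vmeet G g1 g2 \<oplus>\<^bsub>G\<^esub> g' = vmeet G (g1 \<oplus>\<^bsub>G\<^esub> g') (g2 \<oplus>\<^bsub>G\<^esub> g')"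
    using meet.hyps[THEN graph_closed] meet.prems[THEN graph_closed] by (simp add: vjoin_vmeet_add)
  ultimately show ?case
    using graph.meet[OF meet.IH(1)[OF meet.prems] meet.IH(2)[OF meet.prems]] by (simp del: restrict_apply)
qed

text \<open>Scalars are pushed down to the linear forms. A negative scalar exchanges joins and
  meets, on \<open>X\<close> as well as in \<open>G\<close>, so in that case the opposite rule is
  applied.\<close>

lemma graph_scale:
  assumes "graph f g"
  shows "graph (\<lambda>x\<in>X. a * f x) (a \<odot>\<^bsub>G\<^esub> g)"
  using assms
proof (induction rule: graph.induct)
  case (linear c)
  then show ?case
    using graph.linear[OF finsupp_scale[OF linear, of a]] by (simp add: form_scale lin_scale del: restrict_apply)
next
  case (join f1 g1 f2 g2)
  note closed = join.hyps[THEN graph_closed]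
  show ?case
  proof (cases "0 \<le> a")
    case True
    then have "(\<lambda>x\<in>X. a * (\<lambda>x\<in>X. max (f1 x) (f2 x)) x) =
        (\<lambda>x\<in>X. max ((\<lambda>x\<in>X. a * f1 x) x) ((\<lambda>x\<in>X. a * f2 x) x))"
      by (auto simp: fun_eq_iff max_mult_distrib_left)
    with True closed graph.join[OF join.IH] show ?thesis
      by (simp add: smult_vjoin_vmeet_nonneg del: restrict_apply)
  next
    case False
    then have "(\<lambda>x\<in>X. a * (\<lambda>x\<in>X. max (f1 x) (f2 x)) x) =
        (\<lambda>x\<in>X. min ((\<lambda>x\<in>X. a * f1 x) x) ((\<lambda>x\<in>X. a * f2 x) x))"
      by (auto simp: fun_eq_iff max_mult_distrib_left)
    with False closed graph.meet[OF join.IH] show ?thesis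
      by (simp add: smult_vjoin_vmeet_neg del: restrict_apply)
  qed
next
  case (meet f1 g1 f2 g2)
  note closed = meet.hyps[THEN graph_closed]
  show ?case
  proof (cases "0 \<le> a")
    case True
    then have "(\<lambda>x\<in>X. a * (\<lambda>x\<in>X. min (f1 x) (f2 x)) x) =
        (\<lambda>x\<in>X. min ((\<lambda>x\<in>X. a * f1 x) x) ((\<lambda>x\<in>X. a * f2 x) x))"
      by (auto simp: fun_eq_iff min_mult_distrib_left)
    with True closed graph.meet[OF meet.IH] show ?thesis
      by (simp add: smult_vjoin_vmeet_nonneg del: restrict_apply)
  next
    case False
    then have "(\<lambda>x\<in>X. a * (\<lambda>x\<in>X. min (f1 x) (f2 x)) x) =
        (\<lambda>x\<in>X. max ((\<lambda>x\<in>X. a * f1 x) x) ((\<lambda>x\<in>X. a * f2 x) x))"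
      by (auto simp: fun_eq_iff min_mult_distrib_left)
    with False closed graph.join[OF meet.IH] show ?thesis
      by (simp add: smult_vjoin_vmeet_neg del: restrict_apply)
  qed
qed

section \<open>Reduction to suprema of infima\<close>

text \<open>Distributivity, in the reals and in \<open>G\<close>, moves the meet below all joins.
  The outer induction treats the joins of the first argument; when that is a pure infimum, the inner
  one treats those of the second.\<close>

lemma join_meet_graph_meet:
  assumes "join_meet_graph f g" "join_meet_graph f' g'"
  shows "join_meet_graph (\<lambda>x\<in>X. min (f x) (f' x)) (vmeet G g g')"
  using assms
proof (induction arbitrary: f' g' rule: join_meet_graph.induct)
  case (meets f g)
  note fg = meets.hyps
  from meets.prems show ?case
  proof (induction rule: join_meet_graph.induct)
    case (meets f' g')
    then show ?case
      using fg by (intro join_meet_graph.meets meet_graph.meet)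
  next
    case (join f1 g1 f2 g2)
    have "(\<lambda>x\<in>X. min (f x) ((\<lambda>x\<in>X. max (f1 x) (f2 x)) x)) =
        (\<lambda>x\<in>X. max ((\<lambda>x\<in>X. min (f x) (f1 x)) x) ((\<lambda>x\<in>X. min (f x) (f2 x)) x))"
      by (auto simp: fun_eq_iff)
    moreover have "vmeet G g (vjoin G g1 g2) = vjoin G (vmeet G g g1) (vmeet G g g2)"
      using meet_graph_closed[OF fg] join.hyps[THEN join_meet_graph_closed]
      by (simp add: vmeet_vjoin_distrib)
    ultimately show ?case
      using join_meet_graph.join[OF join.IH] by (simp del: restrict_apply)
  qed
next
  case (join f1 g1 f2 g2)
  have "(\<lambda>x\<in>X. min ((\<lambda>x\<in>X. max (f1 x) (f2 x)) x) (f' x)) =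
      (\<lambda>x\<in>X. max ((\<lambda>x\<in>X. min (f1 x) (f' x)) x) ((\<lambda>x\<in>X. min (f2 x) (f' x)) x))"
    by (auto simp: fun_eq_iff)
  moreover have "vmeet G (vjoin G g1 g2) g' = vjoin G (vmeet G g1 g') (vmeet G g2 g')"
    using join.hyps[THEN join_meet_graph_closed] join.prems[THEN join_meet_graph_closed]
    by (simp add: vmeet_vjoin_distrib meet_comm[of _ _ g'])
  ultimately show ?case
    using join_meet_graph.join[OF join.IH(1)[OF join.prems] join.IH(2)[OF join.prems]] by (simp del: restrict_apply)
qed

lemma graph_imp_join_meet_graph: "graph f g \<Longrightarrow> join_meet_graph f g"
proof (induction rule: graph.induct)
  case (linear c)
  then show ?case by (intro join_meet_graph.meets meet_graph.linear)
next
  case (join f g f' g')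
  then show ?case by (intro join_meet_graph.join)
next
  case (meet f g f' g')
  then show ?case by (intro join_meet_graph_meet)
qed

section \<open>Nonpositive expressions and single-valuedness of the graph\<close>

text \<open>\<open>A\<close> collects the forms under the infimum. At each point of \<open>X\<close>
  the minimum is attained by one of them; \<open>G\<close> need not be totally ordered, so there
  only the lower bound is kept.\<close>

lemma meet_graph_forms:
  assumes "meet_graph f g"
  shows "\<exists>A. finite A \<and> A \<noteq> {} \<and> (\<forall>c\<in>A. finsupp c \<and> vle G g (lin c)) \<and>
    (\<forall>x\<in>X. \<exists>c\<in>A. form c x \<le> f x)"
  using assms
proof (induction rule: meet_graph.induct)
  case (linear c)
  then show ?case by (intro exI[of _ "{c}"]) (auto intro: vle_refl)
next
  case (meet f1 g1 f2 g2)
  note closed = meet.hyps[THEN meet_graph_closed]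
  from meet.IH obtain A1 A2 where
    A1: "finite A1" "A1 \<noteq> {}" "\<And>c. c \<in> A1 \<Longrightarrow> finsupp c \<and> vle G g1 (lin c)"
      "\<And>x. x \<in> X \<Longrightarrow> \<exists>c\<in>A1. form c x \<le> f1 x" and
    A2: "finite A2" "A2 \<noteq> {}" "\<And>c. c \<in> A2 \<Longrightarrow> finsupp c \<and> vle G g2 (lin c)"
      "\<And>x. x \<in> X \<Longrightarrow> \<exists>c\<in>A2. form c x \<le> f2 x"
    by metis
  have "\<exists>c\<in>A1 \<union> A2. form c x \<le> min (f1 x) (f2 x)" if "x \<in> X" for x
    using A1(4)[OF that] A2(4)[OF that] by (auto simp: min_def)
  moreover have "vle G (vmeet G g1 g2) (lin c)" if "c \<in> A1 \<union> A2" for c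
    using that A1(3) A2(3) closed by (auto intro: vle_trans[OF vmeet_lower(1)] vle_trans[OF vmeet_lower(2)])
  ultimately show ?case
    using A1 A2 by (intro exI[of _ "A1 \<union> A2"]) auto
qed

lemma meet_graph_nonpos:
  assumes "meet_graph f g" and nonpos: "\<And>x. x \<in> X \<Longrightarrow> f x \<le> 0"
  shows "vle G g \<zero>\<^bsub>G\<^esub>"
proof -
  have g: "g \<in> carrier G" using assms(1) meet_graph_closed by blast
  from meet_graph_forms[OF assms(1)] obtain A where
    A: "finite A" "A \<noteq> {}" "\<And>c. c \<in> A \<Longrightarrow> finsupp c" "\<And>c. c \<in> A \<Longrightarrow> vle G g (lin c)"
      "\<And>x. x \<in> X \<Longrightarrow> \<exists>c\<in>A. form c x \<le> f x"
    by blast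
  define V where "V = (\<Union>c\<in>A. {s. c s \<noteq> 0})"
  have V: "finite V" "V \<subseteq> S" using A(1,3) by (auto simp: V_def finsupp_def)
  \<comment> \<open>A convex cone that contains \<open>A\<close>, with \<open>r = 1\<close>. Adding
    or scaling its members adds or scales the factors \<open>r\<close>, which stay strictly positive
    and can be divided out at the end.\<close>
  define K where "K = {k. {s. k s \<noteq> 0} \<subseteq> V \<and> (\<exists>r>0. vle G (r \<odot>\<^bsub>G\<^esub> g) (lin k))}"
  have K: "finsupp k" if "k \<in> K" for k
    using that V finite_subset[of "{s. k s \<noteq> 0}" V] by (auto simp: K_def finsupp_def)
  have "\<exists>k\<in>K. \<forall>s\<in>V. k s = 0"
  proof (rule cone_meets_kernel[OF V(1) A(1,2)])
    show "A \<subseteq> K"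
      using A(4) g smult_one[of g] by (auto simp: K_def V_def intro!: exI[of _ 1])
  next
    fix k l assume kl: "k \<in> K" "l \<in> K"
    then obtain r q where rq: "0 < r" "0 < q"
      "vle G (r \<odot>\<^bsub>G\<^esub> g) (lin k)" "vle G (q \<odot>\<^bsub>G\<^esub> g) (lin l)"
      by (auto simp: K_def)
    have "vle G (r \<odot>\<^bsub>G\<^esub> g \<oplus>\<^bsub>G\<^esub> q \<odot>\<^bsub>G\<^esub> g) (lin k \<oplus>\<^bsub>G\<^esub> q \<odot>\<^bsub>G\<^esub> g)"
      using rq g K kl by (intro vle_add) (auto simp: smult_closed)
    moreover have "vle G (q \<odot>\<^bsub>G\<^esub> g \<oplus>\<^bsub>G\<^esub> lin k) (lin l \<oplus>\<^bsub>G\<^esub> lin k)"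
      using rq g K kl by (intro vle_add) (auto simp: smult_closed)
    ultimately have "vle G (r \<odot>\<^bsub>G\<^esub> g \<oplus>\<^bsub>G\<^esub> q \<odot>\<^bsub>G\<^esub> g) (lin k \<oplus>\<^bsub>G\<^esub> lin l)"
      using g K[OF kl(1)] K[OF kl(2)]
      by (auto simp: smult_closed M.a_comm intro: vle_trans)
    then have "vle G ((r + q) \<odot>\<^bsub>G\<^esub> g) (lin (\<lambda>s. k s + l s))"
      using g K[OF kl(1)] K[OF kl(2)] smult_l_distr[of r q g] by (simp add: lin_add)
    moreover have "{s. k s + l s \<noteq> 0} \<subseteq> {s. k s \<noteq> 0} \<union> {s. l s \<noteq> 0}" by auto
    then have "{s. k s + l s \<noteq> 0} \<subseteq> V" using kl unfolding K_def by blast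
    ultimately show "(\<lambda>s. k s + l s) \<in> K"
      using rq by (auto simp: K_def intro!: exI[of _ "r + q"])
  next
    fix a :: real and k assume a: "0 < a" and k: "k \<in> K"
    then obtain r where r: "0 < r" "vle G (r \<odot>\<^bsub>G\<^esub> g) (lin k)"
      by (auto simp: K_def)
    have "vle G (a \<odot>\<^bsub>G\<^esub> (r \<odot>\<^bsub>G\<^esub> g)) (a \<odot>\<^bsub>G\<^esub> lin k)"
      using a r g K[OF k] by (intro vle_smult) (auto simp: smult_closed)
    then have "vle G ((a * r) \<odot>\<^bsub>G\<^esub> g) (lin (\<lambda>s. a * k s))"
      using g K[OF k] smult_assoc1[of a r g] by (simp add: lin_scale)
    then show "(\<lambda>s. a * k s) \<in> K"
      using a r k by (auto simp: K_def intro!: exI[of _ "a * r"])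
  next
    fix y :: "'s \<Rightarrow> real"
    \<comment> \<open>Cutting \<open>y\<close> off outside the finite set \<open>V\<close> gives a
      point of \<open>X\<close> at which the forms in \<open>A\<close> have the required values.
      This is why finitely supported functions suffice as test points.\<close>
    define x where "x = (\<lambda>s\<in>S. if s \<in> V then y s else 0)"
    have "finite {s \<in> S. x s \<noteq> 0}"
      by (rule finite_subset[OF _ V(1)]) (auto simp: x_def)
    then have x: "x \<in> X" by (auto simp: Fun00_def x_def)
    then obtain c where c: "c \<in> A" "form c x \<le> 0"
      using A(5) nonpos by (meson order_trans)
    have "form c x = (\<Sum>s\<in>V. c s * x s)"
      using V(1) c(1) x by (intro form_eq_sum) (auto simp: V_def)
    also have "\<dots> = (\<Sum>s\<in>V. c s * y s)"
      using V(2) by (intro sum.cong) (auto simp: x_def)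
    finally show "\<exists>c\<in>A. (\<Sum>s\<in>V. c s * y s) \<le> 0"
      using c by auto
  qed
  then obtain k r where k: "{s. k s \<noteq> 0} \<subseteq> V" "\<forall>s\<in>V. k s = 0"
    and r: "0 < r" "vle G (r \<odot>\<^bsub>G\<^esub> g) (lin k)"
    by (auto simp: K_def)
  \<comment> \<open>The form \<open>k\<close> is supported in \<open>V\<close> and vanishes on
    \<open>V\<close>, so it is zero, and the inequality defining \<open>K\<close> bounds a positive
    multiple of \<open>g\<close> by zero.\<close>
  from k have "{s. k s \<noteq> 0} = {}" by auto
  then have "lin k = \<zero>\<^bsub>G\<^esub>" by (simp only: lin_def M.finsum_empty)
  then have "vle G (inverse r \<odot>\<^bsub>G\<^esub> (r \<odot>\<^bsub>G\<^esub> g)) (inverse r \<odot>\<^bsub>G\<^esub> \<zero>\<^bsub>G\<^esub>)"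
    using r g by (intro vle_smult) (auto simp: smult_closed)
  then show ?thesis
    using r g smult_r_null[of "inverse r"] by (simp add: smult_cancel)
qed

lemma join_meet_graph_nonpos:
  assumes "join_meet_graph f g" "\<And>x. x \<in> X \<Longrightarrow> f x \<le> 0"
  shows "vle G g \<zero>\<^bsub>G\<^esub>"
  using assms
proof (induction rule: join_meet_graph.induct)
  case (meets f g)
  then show ?case by (rule meet_graph_nonpos)
next
  case (join f1 g1 f2 g2)
  have "f1 x \<le> 0" "f2 x \<le> 0" if "x \<in> X" for x
    using join.prems[OF that] that by auto
  with join.IH join.hyps[THEN join_meet_graph_closed] show ?case
    by (auto intro: vjoin_least)
qed

text \<open>Both \<open>f\<close> and its negative are nonpositive on \<open>X\<close>, and the
  negative is paired with the negative of \<open>g\<close>; hence \<open>g\<close> is bounded by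
  zero from both sides.\<close>

lemma graph_zero:
  assumes "graph f g" and zero: "\<And>x. x \<in> X \<Longrightarrow> f x = 0"
  shows "g = \<zero>\<^bsub>G\<^esub>"
proof -
  have g: "g \<in> carrier G" using assms(1) graph_closed by blast
  have "vle G g \<zero>\<^bsub>G\<^esub>"
    using join_meet_graph_nonpos[OF graph_imp_join_meet_graph[OF assms(1)]] zero by simp
  moreover have "vle G ((- 1) \<odot>\<^bsub>G\<^esub> g) \<zero>\<^bsub>G\<^esub>"
    using join_meet_graph_nonpos[OF graph_imp_join_meet_graph[OF graph_scale[OF assms(1)]]] zero
    by simp
  then have "vle G ((- 1) \<odot>\<^bsub>G\<^esub> \<zero>\<^bsub>G\<^esub>) ((- 1) \<odot>\<^bsub>G\<^esub> ((- 1) \<odot>\<^bsub>G\<^esub> g))"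
    using g by (intro vle_neg_smult) (auto simp: smult_closed)
  then have "vle G \<zero>\<^bsub>G\<^esub> g"
    using g smult_cancel(1)[of "- 1" g] smult_r_null[of "- 1"] by simp
  ultimately show ?thesis using g by (auto intro: vle_antisym)
qed

text \<open>The difference of two values paired with \<open>f\<close> is paired with the difference
  of \<open>f\<close> and itself, which is zero on \<open>X\<close>. This makes the extension well
  defined.\<close>

lemma graph_functional:
  assumes "graph f g" "graph f g'"
  shows "g = g'"
proof -
  have c: "g \<in> carrier G" "g' \<in> carrier G" using assms graph_closed by blast+
  have "g \<oplus>\<^bsub>G\<^esub> (- 1) \<odot>\<^bsub>G\<^esub> g' = \<zero>\<^bsub>G\<^esub>"
    by (rule graph_zero[OF graph_add[OF assms(1) graph_scale[OF assms(2)]]]) simp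
  then show ?thesis
    using c M.minus_equality[of g "\<ominus>\<^bsub>G\<^esub> g'"] by (simp add: smult_minus_one)
qed

section \<open>The homomorphism defined by the graph\<close>

abbreviation F :: "(('s \<Rightarrow> real) \<Rightarrow> real) ordered_vs" where
  "F \<equiv> generated_vector_sublattice (Fun X) (evaluation S ` S)"

lemma vector_sublattice_F: "vector_sublattice (Fun X) (carrier F)"
  and carrier_F: "F = (Fun X)\<lparr>carrier := carrier F\<rparr>"
proof -
  interpret Fun: vector_lattice "Fun X" by (rule vector_lattice_Fun)
  have "evaluation S ` S \<subseteq> carrier (Fun X)" by (auto simp: evaluation_def)
  then show "vector_sublattice (Fun X) (carrier F)"
    by (simp add: generated_vector_sublattice_def Fun.vector_sublattice_hull)
  show "F = (Fun X)\<lparr>carrier := carrier F\<rparr>"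
    by (simp add: generated_vector_sublattice_def)
qed

text \<open>The domain of the graph is a vector sublattice of \<open>Fun X\<close> containing the
  evaluations, so it contains the sublattice they generate.\<close>

lemma graph_total: "f \<in> carrier F \<Longrightarrow> \<exists>g. graph f g"
proof -
  assume f: "f \<in> carrier F"
  interpret Fun: vector_lattice "Fun X" by (rule vector_lattice_Fun)
  have ext: "f \<in> carrier (Fun X)" if "graph f g" for f g
    using graph_closed[OF that] by (simp add: PiE_iff)
  have "vector_sublattice (Fun X) {f. \<exists>g. graph f g}"
  proof (rule Fun.vector_sublatticeI)
    have "finsupp (\<lambda>_. 0)" by (simp add: finsupp_def)
    then have "graph (form (\<lambda>_. 0)) (lin (\<lambda>_. 0))" by (rule graph.linear)
    then show "\<zero>\<^bsub>Fun X\<^esub> \<in> {f. \<exists>g. graph f g}" by (auto simp: form_def)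
  next
    fix f f' assume "f \<in> {f. \<exists>g. graph f g}" "f' \<in> {f. \<exists>g. graph f g}"
    then obtain g g' where g: "graph f g" "graph f' g'" by blast
    show "f \<oplus>\<^bsub>Fun X\<^esub> f' \<in> {f. \<exists>g. graph f g}"
      using graph_add[OF g] by auto
    show "vjoin (Fun X) f f' \<in> {f. \<exists>g. graph f g}"
      using graph.join[OF g] vjoin_vmeet_Fun(1)[OF ext[OF g(1)] ext[OF g(2)]] by auto
    show "vmeet (Fun X) f f' \<in> {f. \<exists>g. graph f g}"
      using graph.meet[OF g] vjoin_vmeet_Fun(2)[OF ext[OF g(1)] ext[OF g(2)]] by auto
  qed (use ext in \<open>auto intro: graph_scale\<close>)
  moreover have "evaluation S ` S \<subseteq> {f. \<exists>g. graph f g}"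
  proof clarify
    fix s assume "s \<in> S"
    then have "finsupp (\<lambda>t. if t = s then 1 else 0)" by (simp add: finsupp_def)
    from graph.linear[OF this] show "\<exists>g. graph (evaluation S s) g" by (auto simp: form_single)
  qed
  ultimately have "carrier F \<subseteq> {f. \<exists>g. graph f g}"
    unfolding generated_vector_sublattice_def by (simp add: hull_minimal)
  with f show ?thesis by auto
qed

lemma graph_evaluation: "s \<in> S \<Longrightarrow> graph (evaluation S s) (\<phi> s)"
  using graph.linear[of "\<lambda>t. if t = s then 1 else 0"]
  by (simp add: finsupp_def form_single lin_single)

lemma vjoin_vmeet_F:
  assumes "f \<in> carrier F" "f' \<in> carrier F"
  shows "vjoin F f f' = (\<lambda>x\<in>X. max (f x) (f' x))" "vmeet F f f' = (\<lambda>x\<in>X. min (f x) (f' x))"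
proof -
  interpret Fun: vector_lattice "Fun X" by (rule vector_lattice_Fun)
  have "f \<in> carrier (Fun X)" "f' \<in> carrier (Fun X)"
    using assms vector_sublatticeD(6)[OF vector_sublattice_F] by blast+
  with Fun.vjoin_vmeet_sublattice[OF vector_sublattice_F assms]
  show "vjoin F f f' = (\<lambda>x\<in>X. max (f x) (f' x))" "vmeet F f f' = (\<lambda>x\<in>X. min (f x) (f' x))"
    by (simp_all add: vjoin_vmeet_Fun carrier_F[symmetric] del: Fun_simps)
qed

lemma F_simps:
  "f \<oplus>\<^bsub>F\<^esub> f' = (\<lambda>x\<in>X. f x + f' x)" "a \<odot>\<^bsub>F\<^esub> f = (\<lambda>x\<in>X. a * f x)"
  by (simp_all add: generated_vector_sublattice_def)

lemma F_closed:
  assumes "f \<in> carrier F" "f' \<in> carrier F"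
  shows "f \<oplus>\<^bsub>F\<^esub> f' \<in> carrier F" "a \<odot>\<^bsub>F\<^esub> f \<in> carrier F"
    "vjoin F f f' \<in> carrier F" "vmeet F f f' \<in> carrier F"
proof -
  interpret Fun: vector_lattice "Fun X" by (rule vector_lattice_Fun)
  interpret F: vector_lattice F
    using Fun.vector_sublattice_is_vector_lattice[OF vector_sublattice_F]
    by (simp add: carrier_F[symmetric])
  show "f \<oplus>\<^bsub>F\<^esub> f' \<in> carrier F" "a \<odot>\<^bsub>F\<^esub> f \<in> carrier F"
    "vjoin F f f' \<in> carrier F" "vmeet F f f' \<in> carrier F"
    using assms F.smult_closed[of a f] by simp_all
qed

text \<open>On \<open>carrier F\<close> the graph is total and single-valued, hence a function. Each
  homomorphism identity is then one of its closure properties, read off through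
  \<open>h_eq\<close>.\<close>

lemma extension_exists:
  "\<exists>h. h \<in> vector_lattice_hom F G \<and> (\<forall>s\<in>S. h (evaluation S s) = \<phi> s)"
proof -
  define h where "h = (\<lambda>f\<in>carrier F. THE g. graph f g)"
  have graph_h: "graph f (h f)" if "f \<in> carrier F" for f
    using graph_total[OF that] graph_functional that by (auto simp: h_def intro: theI)
  have h_eq: "h f = g" if "f \<in> carrier F" "graph f g" for f g
    using graph_functional[OF graph_h[OF that(1)] that(2)] .
  have eval: "evaluation S s \<in> carrier F" if "s \<in> S" for s
    using that by (auto simp: generated_vector_sublattice_def intro: hull_inc)
  have "h \<in> vector_lattice_hom F G"
    unfolding vector_lattice_hom_def
  proof (intro CollectI conjI ballI allI)
    show "h \<in> carrier F \<rightarrow>\<^sub>E carrier G"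
      using graph_h graph_closed by (auto simp: h_def)
  next
    fix f f' assume f: "f \<in> carrier F" "f' \<in> carrier F"
    note g = graph_h[OF f(1)] graph_h[OF f(2)]
    show "h (f \<oplus>\<^bsub>F\<^esub> f') = h f \<oplus>\<^bsub>G\<^esub> h f'"
      using F_closed(1)[OF f] graph_add[OF g] by (intro h_eq) (simp_all add: F_simps)
    show "h (vjoin F f f') = vjoin G (h f) (h f')"
      using F_closed(3)[OF f] graph.join[OF g] by (intro h_eq) (simp_all add: vjoin_vmeet_F f)
    show "h (vmeet F f f') = vmeet G (h f) (h f')"
      using F_closed(4)[OF f] graph.meet[OF g] by (intro h_eq) (simp_all add: vjoin_vmeet_F f)
  next
    fix a f assume f: "f \<in> carrier F"
    show "h (a \<odot>\<^bsub>F\<^esub> f) = a \<odot>\<^bsub>G\<^esub> h f"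
      using F_closed(2)[OF f f, of a] graph_scale[OF graph_h[OF f], of a]
      by (intro h_eq) (simp_all add: F_simps)
  qed
  moreover have "\<forall>s\<in>S. h (evaluation S s) = \<phi> s"
    using h_eq eval graph_evaluation by blast
  ultimately show ?thesis by blast
qed

end

section \<open>Uniqueness of the extension and freeness\<close>

text \<open>The equalizer \<open>E\<close> of the two homomorphisms is a vector sublattice
  containing \<open>B\<close>, so it is all of the generated one. Extensionality then upgrades
  agreement on the carrier to equality of functions.\<close>

lemma vector_lattice_hom_eqI:
  assumes V: "vector_lattice V" and B: "B \<subseteq> carrier V"
    and W: "vector_lattice W"
    and h: "h \<in> vector_lattice_hom (generated_vector_sublattice V B) W"
    and h': "h' \<in> vector_lattice_hom (generated_vector_sublattice V B) W"
    and eq: "\<And>b. b \<in> B \<Longrightarrow> h b = h' b"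
  shows "h = h'"
proof -
  interpret V: vector_lattice V by (rule V)
  interpret W: vector_lattice W by (rule W)
  define A where "A = vector_sublattice V hull B"
  define E where "E = {f \<in> A. h f = h' f}"
  have A: "vector_sublattice V A" using V.vector_sublattice_hull[OF B] by (simp add: A_def)
  note A' = vector_sublatticeD[OF A]
  have gen: "generated_vector_sublattice V B = V\<lparr>carrier := A\<rparr>"
    by (simp add: generated_vector_sublattice_def A_def)
  have hom: "k (x \<oplus>\<^bsub>V\<^esub> y) = k x \<oplus>\<^bsub>W\<^esub> k y" "k (a \<odot>\<^bsub>V\<^esub> x) = a \<odot>\<^bsub>W\<^esub> k x"
    "k (vjoin V x y) = vjoin W (k x) (k y)" "k (vmeet V x y) = vmeet W (k x) (k y)"
    "k x \<in> carrier W"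
    if "k \<in> vector_lattice_hom (V\<lparr>carrier := A\<rparr>) W" "x \<in> A" "y \<in> A" for k x y a
    using that by (auto simp: vector_lattice_hom_def V.vjoin_vmeet_sublattice[OF A])
  note h = h[unfolded gen] and h' = h'[unfolded gen]
  \<comment> \<open>Preservation of zero is not among the defining conditions of a homomorphism; it
    follows from homogeneity with the scalar 0.\<close>
  have zero: "k \<zero>\<^bsub>V\<^esub> = \<zero>\<^bsub>W\<^esub>" if "k \<in> vector_lattice_hom (V\<lparr>carrier := A\<rparr>) W" for k
    using hom(2)[OF that A'(7) A'(7), of 0] hom(5)[OF that A'(7) A'(7)]
      V.smult_l_null[of "\<zero>\<^bsub>V\<^esub>"] W.smult_l_null[of "k \<zero>\<^bsub>V\<^esub>"] by simp
  have "vector_sublattice V E"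
    by (rule V.vector_sublatticeI) (use A' hom[OF h] hom[OF h'] zero[OF h] zero[OF h'] in \<open>auto simp: E_def\<close>)
  moreover have "B \<subseteq> E"
    using eq by (auto simp: E_def A_def intro: hull_inc)
  ultimately have "A \<subseteq> E" unfolding A_def by (rule hull_minimal[rotated])
  moreover have "h \<in> extensional A" "h' \<in> extensional A"
    using h h' by (auto simp: vector_lattice_hom_def PiE_def)
  ultimately show ?thesis
    by (intro extensionalityI[of h A h']) (auto simp: E_def)
qed

theorem proposition2p7:
  fixes S :: "'s set"
  assumes "S \<noteq> {}"
  shows "free_vector_lattice TYPE('g) S (evaluation S)
    (generated_vector_sublattice (Fun (carrier (Fun00 S))) (evaluation S ` S))"
    (is "free_vector_lattice _ _ _ ?F")
  unfolding free_vector_lattice_def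
proof (intro conjI allI impI ballI)
  interpret Fun: vector_lattice "Fun (carrier (Fun00 S))" by (rule vector_lattice_Fun)
  have B: "evaluation S ` S \<subseteq> carrier (Fun (carrier (Fun00 S)))"
    by (auto simp: evaluation_def)
  show "vector_lattice ?F"
    unfolding generated_vector_sublattice_def
    by (intro Fun.vector_sublattice_is_vector_lattice Fun.vector_sublattice_hull B)
  show "evaluation S \<in> S \<rightarrow> carrier ?F"
    by (auto simp: generated_vector_sublattice_def intro: hull_inc)
  fix G :: "'g ordered_vs" and \<phi> :: "'s \<Rightarrow> 'g"
  assume G: "vector_lattice G" and \<phi>: "\<phi> \<in> S \<rightarrow> carrier G"
  interpret vector_lattice_family G S \<phi>
    using G \<phi> by (intro vector_lattice_family.intro vector_lattice_family_axioms.intro)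
  from extension_exists obtain h where
    h: "h \<in> vector_lattice_hom ?F G" "\<forall>s\<in>S. h (evaluation S s) = \<phi> s"
    by blast
  show "\<exists>!h. h \<in> vector_lattice_hom ?F G \<and> (\<forall>s\<in>S. h (evaluation S s) = \<phi> s)"
  proof (rule ex1I[of _ h])
    fix h' assume "h' \<in> vector_lattice_hom ?F G \<and> (\<forall>s\<in>S. h' (evaluation S s) = \<phi> s)"
    with h show "h' = h"
      by (intro vector_lattice_hom_eqI[OF Fun.vector_lattice_axioms B G]) auto
  qed (use h in blast)
qed

end
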